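(* Let $(M,\phi,\xi,\eta,g,\nabla=\nabla^\circ+K)$ be an almost contact statistical manifold whose statistical connection is $\phi$-compatible, i.e. $\nabla\phi=0$. Then $M$ is a cosymplectic statistical manifold (i.e. $\nabla^\circ\phi=0$) with $\phi$-sectional $K$-curvature $\mathcal{K}_\phi=0$.
   Context: An almost contact metric manifold $(M,\phi,\xi,\eta,g)$ is an odd-dimensional smooth manifold $M$ with a $(1,1)$-tensor field $\phi$, a vector field $\xi$, a 1-form $\eta$ and a Riemannian metric $g$ satisfying $\phi^2=-I+\eta\otimes\xi$, $\eta(\xi)=1$ and $g(\phi X,\phi Y)=g(X,Y)-\eta(X)\eta(Y)$ for all vector fields $X,Y$. Let $\nabla^\circ$ be the Levi-Civita connection of $g$. A statistical structure on $M$ is a pair $(g,\nabla)$ with $\nabla$ a torsion-free affine connection such that the 3-tensor $\nabla g$ is totally symmetric; put $K=\nabla-\nabla^\circ$, a $(1,2)$-tensor field which is symmetric, and such that $g(X,K(Y,Z))$ is totally symmetric in $X,Y,Z$. An almost contact statistical manifold $(M,\phi,\xi,\eta,g,\nabla=\nabla^\circ+K)$ is an almost contact metric manifold with a statistical structure $(g,\nabla)$ such that $K(X,\phi Y)+\phi K(X,Y)=0$ for all vector fields $X,Y$. An almost contact metric manifold is cosymplectic if $\nabla^\circ\phi=0$; a cosymplectic statistical manifold is an almost contact statistical manifold whose underlying almost contact metric manifold is cosymplectic. Here $(\nabla_X\phi)Y=\nabla_X(\phi Y)-\phi\nabla_XY$. Write $K_XY=K(X,Y)$ and $[K,K](X,Y)Z=K_XK_YZ-K_YK_XZ$.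 A $\phi$-section of $T_pM$ is a 2-dimensional subspace spanned by $\{X,\phi X\}$ for some $X\in T_pM$ orthogonal to $\xi$; its $\phi$-sectional $K$-curvature is $\mathcal{K}_\phi(X)=g([K,K](X,\phi X)\phi X,X)/Q(X,\phi X)$, where $Q(X,\phi X)=g(X,X)g(\phi X,\phi X)-g(X,\phi X)^2$. $\mathcal{K}_\phi=0$ means it vanishes at all points for all $\phi$-sections. *)

theory Defs
  imports "HOL-Analysis.Analysis" "HOL-Library.Function_Algebras"
begin

section \<open>Smooth manifolds\<close>

text \<open>Class \<open>C\<^sup>k\<close> on an open set: all iterated directional derivatives up to order \<open>k\<close> exist and
  are differentiable resp. continuous.\<close>

primrec Ck_on :: "nat \<Rightarrow> 'v::real_normed_vector set \<Rightarrow> ('v \<Rightarrow> 'w::real_normed_vector) \<Rightarrow> bool" where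
  "Ck_on 0 S f \<longleftrightarrow> continuous_on S f"
| "Ck_on (Suc k) S f \<longleftrightarrow>
     (\<forall>x\<in>S. f differentiable (at x)) \<and> (\<forall>v. Ck_on k S (\<lambda>x. frechet_derivative f (at x) v))"

definition smooth_on :: "'v::real_normed_vector set \<Rightarrow> ('v \<Rightarrow> 'w::real_normed_vector) \<Rightarrow> bool" where
  "smooth_on S f \<longleftrightarrow> open S \<and> (\<forall>k. Ck_on k S f)"

text \<open>A manifold is a Hausdorff, second countable space, given as a type \<open>'a\<close>, with an atlas of
  charts into a Euclidean space \<open>'e\<close>; its dimension is \<open>DIM('e)\<close>. A chart is a pair of its domain
  and its coordinate map (the values of the coordinate map outside the domain are irrelevant).\<close>

type_synonym ('a, 'e) chart = "'a set \<times> ('a \<Rightarrow> 'e)"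

definition is_chart :: "('a::topological_space, 'e::euclidean_space) chart \<Rightarrow> bool" where
  "is_chart c \<longleftrightarrow> (case c of (U, x) \<Rightarrow>
     open U \<and> open (x ` U) \<and> homeomorphism U (x ` U) x (inv_into U x))"

definition smooth_atlas ::
  "('a::{t2_space,second_countable_topology}, 'e::euclidean_space) chart set \<Rightarrow> bool" where
  "smooth_atlas A \<longleftrightarrow>
     (\<forall>c\<in>A. is_chart c) \<and> (\<Union>(U, x)\<in>A. U) = UNIV \<and>
     (\<forall>(U, x)\<in>A. \<forall>(V, y)\<in>A. smooth_on (x ` (U \<inter> V)) (y \<circ> inv_into U x))"

definition smooth_fun :: "('a, 'e::euclidean_space) chart set \<Rightarrow> ('a \<Rightarrow> real) \<Rightarrow> bool" where
  "smooth_fun A f \<longleftrightarrow> (\<forall>(U, x)\<in>A. smooth_on (x ` U) (f \<circ> inv_into U x))"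

definition smooth_curve ::
  "('a::topological_space, 'e::euclidean_space) chart set \<Rightarrow> real \<Rightarrow> (real \<Rightarrow> 'a) \<Rightarrow> bool" where
  "smooth_curve A e \<gamma> \<longleftrightarrow> continuous_on {-e<..<e} \<gamma> \<and>
     (\<forall>(U, x)\<in>A. smooth_on ({-e<..<e} \<inter> \<gamma> -` U) (x \<circ> \<gamma>))"

section \<open>Tangent vectors and vector fields\<close>

text \<open>A tangent vector at \<open>p\<close> is the velocity \<open>f \<mapsto> (f \<circ> \<gamma>)'(0)\<close> of a smooth curve \<open>\<gamma>\<close> with
  \<open>\<gamma>(0) = p\<close>, as an operator on smooth functions. It is set to 0 on all other functions, so
  that tangent vectors are equal iff they agree on smooth functions. Addition, subtraction and
  negation of tangent vectors and of vector fields are pointwise.\<close>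

type_synonym 'a tangent = "('a \<Rightarrow> real) \<Rightarrow> real"
type_synonym 'a vfield = "'a \<Rightarrow> 'a tangent"

definition tscale :: "real \<Rightarrow> 'a tangent \<Rightarrow> 'a tangent" where
  "tscale c v = (\<lambda>f. c * v f)"

interpretation tan: vector_space tscale
  by unfold_locales (auto simp: tscale_def fun_eq_iff algebra_simps)

definition velocity ::
  "('a, 'e::euclidean_space) chart set \<Rightarrow> (real \<Rightarrow> 'a) \<Rightarrow> 'a tangent" where
  "velocity A \<gamma> = (\<lambda>f. if smooth_fun A f then deriv (f \<circ> \<gamma>) 0 else 0)"

definition tangent_space ::
  "('a::topological_space, 'e::euclidean_space) chart set \<Rightarrow> 'a \<Rightarrow> 'a tangent set" where
  "tangent_space A p = {velocity A \<gamma> | \<gamma> e. e > 0 \<and> smooth_curve A e \<gamma> \<and> \<gamma> 0 = p}"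

definition dfun :: "'a vfield \<Rightarrow> ('a \<Rightarrow> real) \<Rightarrow> 'a \<Rightarrow> real" where
  "dfun X f = (\<lambda>p. X p f)"

definition fscale :: "('a \<Rightarrow> real) \<Rightarrow> 'a vfield \<Rightarrow> 'a vfield" where
  "fscale h X = (\<lambda>p. tscale (h p) (X p))"

definition vfields ::
  "('a::topological_space, 'e::euclidean_space) chart set \<Rightarrow> 'a vfield set" where
  "vfields A = {X. (\<forall>p. X p \<in> tangent_space A p) \<and>
                   (\<forall>f. smooth_fun A f \<longrightarrow> smooth_fun A (dfun X f))}"

definition lie_bracket ::
  "('a, 'e::euclidean_space) chart set \<Rightarrow> 'a vfield \<Rightarrow> 'a vfield \<Rightarrow> 'a vfield" where
  "lie_bracket A X Y =
     (\<lambda>p f. if smooth_fun A f then dfun X (dfun Y f) p - dfun Y (dfun X f) p else 0)"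

section \<open>Tensor fields\<close>

text \<open>Tensor fields are families of multilinear maps on the tangent spaces that take smooth vector
  fields to smooth vector fields resp. smooth functions.\<close>

definition one_form ::
  "('a::topological_space, 'e::euclidean_space) chart set \<Rightarrow> ('a \<Rightarrow> 'a tangent \<Rightarrow> real) \<Rightarrow> bool" where
  "one_form A \<eta> \<longleftrightarrow>
     (\<forall>p. \<forall>u\<in>tangent_space A p. \<forall>v\<in>tangent_space A p. \<eta> p (u + v) = \<eta> p u + \<eta> p v) \<and>
     (\<forall>p. \<forall>u\<in>tangent_space A p. \<forall>c. \<eta> p (tscale c u) = c * \<eta> p u) \<and>
     (\<forall>X\<in>vfields A. smooth_fun A (\<lambda>p. \<eta> p (X p)))"

definition apply11 :: "('a \<Rightarrow> 'a tangent \<Rightarrow> 'a tangent) \<Rightarrow> 'a vfield \<Rightarrow> 'a vfield" where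
  "apply11 \<phi> X = (\<lambda>p. \<phi> p (X p))"

definition tensor11 ::
  "('a::topological_space, 'e::euclidean_space) chart set
    \<Rightarrow> ('a \<Rightarrow> 'a tangent \<Rightarrow> 'a tangent) \<Rightarrow> bool" where
  "tensor11 A \<phi> \<longleftrightarrow>
     (\<forall>p. \<forall>u\<in>tangent_space A p. \<phi> p u \<in> tangent_space A p) \<and>
     (\<forall>p. \<forall>u\<in>tangent_space A p. \<forall>v\<in>tangent_space A p. \<phi> p (u + v) = \<phi> p u + \<phi> p v) \<and>
     (\<forall>p. \<forall>u\<in>tangent_space A p. \<forall>c. \<phi> p (tscale c u) = tscale c (\<phi> p u)) \<and>
     (\<forall>X\<in>vfields A. apply11 \<phi> X \<in> vfields A)"

definition apply12 ::
  "('a \<Rightarrow> 'a tangent \<Rightarrow> 'a tangent \<Rightarrow> 'a tangent) \<Rightarrow> 'a vfield \<Rightarrow> 'a vfield \<Rightarrow> 'a vfield" where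
  "apply12 K X Y = (\<lambda>p. K p (X p) (Y p))"

definition tensor12 ::
  "('a::topological_space, 'e::euclidean_space) chart set
    \<Rightarrow> ('a \<Rightarrow> 'a tangent \<Rightarrow> 'a tangent \<Rightarrow> 'a tangent) \<Rightarrow> bool" where
  "tensor12 A K \<longleftrightarrow>
     (\<forall>p. \<forall>u\<in>tangent_space A p. \<forall>v\<in>tangent_space A p. K p u v \<in> tangent_space A p) \<and>
     (\<forall>p. \<forall>u\<in>tangent_space A p. \<forall>v\<in>tangent_space A p. \<forall>w\<in>tangent_space A p.
        K p (u + v) w = K p u w + K p v w \<and> K p w (u + v) = K p w u + K p w v) \<and>
     (\<forall>p. \<forall>u\<in>tangent_space A p. \<forall>v\<in>tangent_space A p. \<forall>c.
        K p (tscale c u) v = tscale c (K p u v) \<and> K p u (tscale c v) = tscale c (K p u v)) \<and>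
     (\<forall>X\<in>vfields A. \<forall>Y\<in>vfields A. apply12 K X Y \<in> vfields A)"

definition metric_fun ::
  "('a \<Rightarrow> 'a tangent \<Rightarrow> 'a tangent \<Rightarrow> real) \<Rightarrow> 'a vfield \<Rightarrow> 'a vfield \<Rightarrow> 'a \<Rightarrow> real" where
  "metric_fun g X Y = (\<lambda>p. g p (X p) (Y p))"

definition riemannian_metric ::
  "('a::topological_space, 'e::euclidean_space) chart set
    \<Rightarrow> ('a \<Rightarrow> 'a tangent \<Rightarrow> 'a tangent \<Rightarrow> real) \<Rightarrow> bool" where
  "riemannian_metric A g \<longleftrightarrow>
     (\<forall>p. \<forall>u\<in>tangent_space A p. \<forall>v\<in>tangent_space A p. \<forall>w\<in>tangent_space A p.
        g p (u + v) w = g p u w + g p v w) \<and>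
     (\<forall>p. \<forall>u\<in>tangent_space A p. \<forall>v\<in>tangent_space A p. \<forall>c. g p (tscale c u) v = c * g p u v) \<and>
     (\<forall>p. \<forall>u\<in>tangent_space A p. \<forall>v\<in>tangent_space A p. g p u v = g p v u) \<and>
     (\<forall>p. \<forall>u\<in>tangent_space A p. u \<noteq> 0 \<longrightarrow> g p u u > 0) \<and>
     (\<forall>X\<in>vfields A. \<forall>Y\<in>vfields A. smooth_fun A (metric_fun g X Y))"

section \<open>Affine connections\<close>

text \<open>A connection is an operation on smooth vector fields; its values on other arguments are
  irrelevant.\<close>

type_synonym 'a connection = "'a vfield \<Rightarrow> 'a vfield \<Rightarrow> 'a vfield"

definition affine_connection ::
  "('a::topological_space, 'e::euclidean_space) chart set \<Rightarrow> 'a connection \<Rightarrow> bool" where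
  "affine_connection A D \<longleftrightarrow>
     (\<forall>X\<in>vfields A. \<forall>Y\<in>vfields A. D X Y \<in> vfields A) \<and>
     (\<forall>X\<in>vfields A. \<forall>Y\<in>vfields A. \<forall>Z\<in>vfields A.
        D (X + Y) Z = D X Z + D Y Z \<and> D X (Y + Z) = D X Y + D X Z) \<and>
     (\<forall>X\<in>vfields A. \<forall>Y\<in>vfields A. \<forall>f. smooth_fun A f \<longrightarrow>
        D (fscale f X) Y = fscale f (D X Y) \<and>
        D X (fscale f Y) = fscale (dfun X f) Y + fscale f (D X Y))"

definition torsion_free ::
  "('a::topological_space, 'e::euclidean_space) chart set \<Rightarrow> 'a connection \<Rightarrow> bool" where
  "torsion_free A D \<longleftrightarrow>
     (\<forall>X\<in>vfields A. \<forall>Y\<in>vfields A. D X Y - D Y X = lie_bracket A X Y)"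

definition cov_metric ::
  "'a connection \<Rightarrow> ('a \<Rightarrow> 'a tangent \<Rightarrow> 'a tangent \<Rightarrow> real)
    \<Rightarrow> 'a vfield \<Rightarrow> 'a vfield \<Rightarrow> 'a vfield \<Rightarrow> 'a \<Rightarrow> real" where
  "cov_metric D g X Y Z =
     dfun X (metric_fun g Y Z) - metric_fun g (D X Y) Z - metric_fun g Y (D X Z)"

definition cov_tensor11 ::
  "'a connection \<Rightarrow> ('a \<Rightarrow> 'a tangent \<Rightarrow> 'a tangent) \<Rightarrow> 'a vfield \<Rightarrow> 'a vfield \<Rightarrow> 'a vfield" where
  "cov_tensor11 D \<phi> X Y = D X (apply11 \<phi> Y) - apply11 \<phi> (D X Y)"

definition parallel11 ::
  "('a::topological_space, 'e::euclidean_space) chart set \<Rightarrow> 'a connection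
    \<Rightarrow> ('a \<Rightarrow> 'a tangent \<Rightarrow> 'a tangent) \<Rightarrow> bool" where
  "parallel11 A D \<phi> \<longleftrightarrow> (\<forall>X\<in>vfields A. \<forall>Y\<in>vfields A. cov_tensor11 D \<phi> X Y = 0)"

definition levi_civita ::
  "('a::topological_space, 'e::euclidean_space) chart set
    \<Rightarrow> ('a \<Rightarrow> 'a tangent \<Rightarrow> 'a tangent \<Rightarrow> real) \<Rightarrow> 'a connection \<Rightarrow> bool" where
  "levi_civita A g D \<longleftrightarrow> affine_connection A D \<and> torsion_free A D \<and>
     (\<forall>X\<in>vfields A. \<forall>Y\<in>vfields A. \<forall>Z\<in>vfields A. cov_metric D g X Y Z = 0)"

definition statistical_structure ::
  "('a::topological_space, 'e::euclidean_space) chart set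
    \<Rightarrow> ('a \<Rightarrow> 'a tangent \<Rightarrow> 'a tangent \<Rightarrow> real) \<Rightarrow> 'a connection \<Rightarrow> bool" where
  "statistical_structure A g D \<longleftrightarrow> affine_connection A D \<and> torsion_free A D \<and>
     (\<forall>X\<in>vfields A. \<forall>Y\<in>vfields A. \<forall>Z\<in>vfields A.
        cov_metric D g X Y Z = cov_metric D g Y X Z \<and>
        cov_metric D g X Y Z = cov_metric D g X Z Y)"

section \<open>Almost contact statistical manifolds\<close>

locale almost_contact_metric_manifold =
  fixes A :: "('a::{t2_space,second_countable_topology}, 'e::euclidean_space) chart set"
    and \<phi> :: "'a \<Rightarrow> 'a tangent \<Rightarrow> 'a tangent"
    and \<xi> :: "'a vfield"
    and \<eta> :: "'a \<Rightarrow> 'a tangent \<Rightarrow> real"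
    and g :: "'a \<Rightarrow> 'a tangent \<Rightarrow> 'a tangent \<Rightarrow> real"
  assumes atlas: "smooth_atlas A"
    and odd_dim: "odd DIM('e)"
    and phi_tensor: "tensor11 A \<phi>"
    and xi_vfield: "\<xi> \<in> vfields A"
    and eta_form: "one_form A \<eta>"
    and metric: "riemannian_metric A g"
    and phi_sq: "\<And>p u. u \<in> tangent_space A p \<Longrightarrow> \<phi> p (\<phi> p u) = - u + tscale (\<eta> p u) (\<xi> p)"
    and eta_xi: "\<And>p. \<eta> p (\<xi> p) = 1"
    and g_phi: "\<And>X Y p. X \<in> vfields A \<Longrightarrow> Y \<in> vfields A \<Longrightarrow>
       g p (\<phi> p (X p)) (\<phi> p (Y p)) = g p (X p) (Y p) - \<eta> p (X p) * \<eta> p (Y p)"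

text \<open>\<open>D0\<close> is the Levi-Civita connection of \<open>g\<close> and \<open>K\<close> is the difference tensor of the
  statistical connection \<open>D\<close>, so that \<open>D = D0 + K\<close>. The symmetry of \<open>K\<close> and the total symmetry of
  \<open>g(X, K(Y, Z))\<close> are consequences of these assumptions.\<close>

locale almost_contact_statistical_manifold = almost_contact_metric_manifold A \<phi> \<xi> \<eta> g
  for A :: "('a::{t2_space,second_countable_topology}, 'e::euclidean_space) chart set"
    and \<phi> \<xi> \<eta> g +
  fixes D D0 :: "'a connection"
    and K :: "'a \<Rightarrow> 'a tangent \<Rightarrow> 'a tangent \<Rightarrow> 'a tangent"
  assumes LC: "levi_civita A g D0"
    and stat: "statistical_structure A g D"
    and K_tensor: "tensor12 A K"
    and D_eq: "\<And>X Y. X \<in> vfields A \<Longrightarrow> Y \<in> vfields A \<Longrightarrow> D X Y = D0 X Y + apply12 K X Y"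
    and K_phi: "\<And>X Y. X \<in> vfields A \<Longrightarrow> Y \<in> vfields A \<Longrightarrow>
       apply12 K X (apply11 \<phi> Y) + apply11 \<phi> (apply12 K X Y) = 0"

locale cosymplectic_statistical_manifold = almost_contact_statistical_manifold A \<phi> \<xi> \<eta> g D D0 K
  for A :: "('a::{t2_space,second_countable_topology}, 'e::euclidean_space) chart set"
    and \<phi> \<xi> \<eta> g D D0 K +
  assumes cosymplectic: "parallel11 A D0 \<phi>"

definition K_bracket ::
  "('a \<Rightarrow> 'a tangent \<Rightarrow> 'a tangent \<Rightarrow> 'a tangent)
    \<Rightarrow> 'a \<Rightarrow> 'a tangent \<Rightarrow> 'a tangent \<Rightarrow> 'a tangent \<Rightarrow> 'a tangent" where
  "K_bracket K p u v w = K p u (K p v w) - K p v (K p u w)"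

definition phi_sectional_K_curvature ::
  "('a \<Rightarrow> 'a tangent \<Rightarrow> 'a tangent) \<Rightarrow> ('a \<Rightarrow> 'a tangent \<Rightarrow> 'a tangent \<Rightarrow> real)
    \<Rightarrow> ('a \<Rightarrow> 'a tangent \<Rightarrow> 'a tangent \<Rightarrow> 'a tangent) \<Rightarrow> 'a \<Rightarrow> 'a tangent \<Rightarrow> real" where
  "phi_sectional_K_curvature \<phi> g K p u =
     g p (K_bracket K p u (\<phi> p u) (\<phi> p u)) u /
     (g p u u * g p (\<phi> p u) (\<phi> p u) - (g p u (\<phi> p u))\<^sup>2)"

definition generates_phi_section ::
  "('a::topological_space, 'e::euclidean_space) chart set \<Rightarrow> ('a \<Rightarrow> 'a tangent \<Rightarrow> 'a tangent)
    \<Rightarrow> 'a vfield \<Rightarrow> ('a \<Rightarrow> 'a tangent \<Rightarrow> 'a tangent \<Rightarrow> real) \<Rightarrow> 'a \<Rightarrow> 'a tangent \<Rightarrow> bool" where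
  "generates_phi_section A \<phi> \<xi> g p u \<longleftrightarrow>
     u \<in> tangent_space A p \<and> g p u (\<xi> p) = 0 \<and> tan.dim (tan.span {u, \<phi> p u}) = 2"

end

theory Submission
  imports Defs "HOL-Real_Asymp.Real_Asymp"
begin

text \<open>Write \<open>\<nabla> = D\<close> and \<open>\<nabla>\<^sup>0 = D0\<close>, so that \<open>\<nabla> = \<nabla>\<^sup>0 + K\<close>. Since \<open>K(X,\<phi>Y) = -\<phi>K(X,Y)\<close>, the condition
  \<open>\<nabla>\<phi> = 0\<close> reads \<open>(\<nabla>\<^sup>0\<^sub>X \<phi>)Y = -2 K(X,\<phi>Y)\<close>. Paired with \<open>Z\<close>, the left hand side is antisymmetric in \<open>Y\<close>
  and \<open>Z\<close>, because \<open>\<phi>\<close> is skew for \<open>g\<close> (\<open>phi_skew\<close>) and \<open>\<nabla>\<^sup>0\<close> is metric. The right hand side is symmetric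
  in \<open>Y\<close> and \<open>Z\<close>, because \<open>g(K(X,Y),Z)\<close> is totally symmetric (\<open>K_sym\<close>, \<open>g_K_sym\<close>). Both sides therefore
  vanish: \<open>K(X,\<phi>Y) = 0\<close> (\<open>K_phi_zero\<close>) and \<open>\<nabla>\<^sup>0\<phi> = 0\<close>. The \<open>\<phi>\<close>-sectional \<open>K\<close>-curvature is zero since both
  terms of \<open>[K,K](u,\<phi>u)\<phi>u = K(u,K(\<phi>u,\<phi>u)) - K(\<phi>u,K(u,\<phi>u))\<close> contain a factor \<open>K(\<cdot>,\<phi>u)\<close>.

  The hypotheses speak about vector fields and the curvature about single tangent vectors. The
  passage between them needs an extension of every tangent vector to a smooth vector field
  (\<open>vector_field_through\<close>). This rests on the description of tangent spaces in coordinates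
  (\<open>tangent_space_coord\<close>), on the closure of smooth functions under products and compositions and on
  smooth bump functions (\<open>smooth_bump_exists\<close>).\<close>

section \<open>Calculus of the classes \<open>C\<^sup>k\<close>\<close>

text \<open>The class \<open>C\<^sup>k\<close> on an open set depends only on the values there. Hence the formulas for
  derivatives supplied below, which are valid on the set only, may stand in for the derivative
  operator, which is how every closure property of \<open>C\<^sup>k\<close> is proved.\<close>

lemma Ck_on_cong:
  assumes "open S"
  shows "(\<And>x. x \<in> S \<Longrightarrow> f x = g x) \<Longrightarrow> Ck_on k S g \<Longrightarrow> Ck_on k S f"
proof (induction k arbitrary: f g)
  case 0
  then show ?case using continuous_on_cong by fastforce
next
  case (Suc k)
  have *: "(f has_derivative frechet_derivative g (at x)) (at x)" if "x \<in> S" for x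
  proof (rule has_derivative_transform_within_open[OF _ \<open>open S\<close> that])
    show "(g has_derivative frechet_derivative g (at x)) (at x)"
      using Suc.prems(2) that by (simp add: frechet_derivative_works)
  qed (simp add: Suc.prems(1))
  then have "frechet_derivative f (at x) = frechet_derivative g (at x)" if "x \<in> S" for x
    using frechet_derivative_at that by metis
  then have "Ck_on k S (\<lambda>x. frechet_derivative f (at x) v)" for v
    using Suc.prems(2) by (auto intro: Suc.IH[of _ "\<lambda>x. frechet_derivative g (at x) v"])
  then show ?case
    using * by (auto simp: differentiable_def)
qed

lemma Ck_on_Suc_intro:
  assumes "\<And>x. x \<in> S \<Longrightarrow> (f has_derivative f' x) (at x)"
    and "\<And>v. Ck_on k S (\<lambda>x. f' x v)" and "open S"
  shows "Ck_on (Suc k) S f"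
proof -
  have "frechet_derivative f (at x) v = f' x v" if "x \<in> S" for x v
    using frechet_derivative_at[OF assms(1)[OF that]] by simp
  then have "Ck_on k S (\<lambda>x. frechet_derivative f (at x) v)" for v
    by (intro Ck_on_cong[OF \<open>open S\<close> _ assms(2)])
  then show ?thesis
    using assms(1) by (auto simp: differentiable_def)
qed

lemma Ck_on_has_derivative:
  "Ck_on (Suc k) S f \<Longrightarrow> x \<in> S \<Longrightarrow> (f has_derivative frechet_derivative f (at x)) (at x)"
  by (simp add: frechet_derivative_works)

lemma Ck_on_Suc_imp: "Ck_on (Suc k) S f \<Longrightarrow> Ck_on k S f"
proof (induction k arbitrary: f)
  case 0
  then show ?case
    by (auto intro!: continuous_at_imp_continuous_on differentiable_imp_continuous_within)
next
  case (Suc k)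
  then show ?case by (metis Ck_on.simps(2))
qed

lemma Ck_on_subset: "Ck_on k S f \<Longrightarrow> T \<subseteq> S \<Longrightarrow> Ck_on k T f"
  by (induction k arbitrary: f) (auto intro: continuous_on_subset)

lemma Ck_on_Un:
  "open S \<Longrightarrow> open T \<Longrightarrow> Ck_on k S f \<Longrightarrow> Ck_on k T f \<Longrightarrow> Ck_on k (S \<union> T) f"
  by (induction k arbitrary: f) (auto intro: continuous_on_open_Un)

lemma Ck_on_const: "Ck_on k S (\<lambda>_. c)"
  by (induction k arbitrary: c) simp_all

lemma Ck_on_add:
  "open S \<Longrightarrow> Ck_on k S f \<Longrightarrow> Ck_on k S g \<Longrightarrow> Ck_on k S (\<lambda>x. f x + g x)"
proof (induction k arbitrary: f g)
  case 0
  then show ?case by (simp add: continuous_on_add)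
next
  case (Suc k)
  show ?case
    by (rule Ck_on_Suc_intro[where
          f'="\<lambda>x v. frechet_derivative f (at x) v + frechet_derivative g (at x) v"])
       (use Suc in \<open>auto intro!: has_derivative_add frechet_derivative_works[THEN iffD1]\<close>)
qed

lemma Ck_on_sum:
  "finite I \<Longrightarrow> open S \<Longrightarrow> (\<And>i. i \<in> I \<Longrightarrow> Ck_on k S (f i)) \<Longrightarrow> Ck_on k S (\<lambda>x. \<Sum>i\<in>I. f i x)"
  by (induction I rule: finite_induct) (auto intro: Ck_on_const Ck_on_add)

lemma Ck_on_linear:
  assumes L: "bounded_linear L" and "open S"
  shows "Ck_on k S f \<Longrightarrow> Ck_on k S (\<lambda>x. L (f x))"
proof (induction k arbitrary: f)
  case 0
  then show ?case by (simp add: bounded_linear.continuous_on[OF L])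
next
  case (Suc k)
  show ?case
    by (rule Ck_on_Suc_intro[where f'="\<lambda>x v. L (frechet_derivative f (at x) v)"])
       (use Suc \<open>open S\<close> in \<open>auto intro!: bounded_linear.has_derivative[OF L] frechet_derivative_works[THEN iffD1]\<close>)
qed

lemma Ck_on_scaleR:
  fixes a :: "_ \<Rightarrow> real"
  shows "open S \<Longrightarrow> Ck_on k S a \<Longrightarrow> Ck_on k S f \<Longrightarrow> Ck_on k S (\<lambda>x. a x *\<^sub>R f x)"
proof (induction k arbitrary: a f)
  case 0
  then show ?case by (simp add: continuous_on_scaleR)
next
  case (Suc k)
  have "Ck_on k S a" "Ck_on k S f" using Suc.prems Ck_on_Suc_imp by blast+
  then show ?case
    by (intro Ck_on_Suc_intro[where f'="\<lambda>x v. a x *\<^sub>R frechet_derivative f (at x) v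
              + frechet_derivative a (at x) v *\<^sub>R f x"])
       (use Suc in \<open>auto intro!: has_derivative_scaleR frechet_derivative_works[THEN iffD1] Ck_on_add\<close>)
qed

lemma Ck_on_id: "open S \<Longrightarrow> Ck_on k S (\<lambda>x. x)"
proof (cases k)
  case (Suc j)
  assume "open S"
  then show ?thesis unfolding Suc
    by (intro Ck_on_Suc_intro[where f'="\<lambda>_ v. v"]) (auto intro: Ck_on_const)
qed simp

text \<open>Induction on \<open>k\<close>. By the chain rule a directional derivative of \<open>g \<circ> f\<close> is the derivative of \<open>g\<close>
  in a direction that itself varies with the point. Expanding this direction in the standard basis
  turns it into a sum of products of \<open>C\<^sup>k\<close> functions with compositions of \<open>f\<close> and the derivatives
  of \<open>g\<close> in fixed directions, to which the induction hypothesis applies.\<close>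

lemma Ck_on_compose:
  fixes f :: "'v::real_normed_vector \<Rightarrow> 'u::euclidean_space"
    and g :: "'u \<Rightarrow> 'w::real_normed_vector"
  assumes "open S" "f ` S \<subseteq> T"
  shows "Ck_on k T g \<Longrightarrow> Ck_on k S f \<Longrightarrow> Ck_on k S (\<lambda>x. g (f x))"
proof (induction k arbitrary: g)
  case 0
  then show ?case using assms continuous_on_compose2 by auto
next
  case (Suc k)
  let ?g = "\<lambda>b y. frechet_derivative g (at y) b"
  let ?f = "\<lambda>v x. frechet_derivative f (at x) v"
  have f: "Ck_on k S f" using Suc.prems Ck_on_Suc_imp by blast
  have "((\<lambda>x. g (f x)) has_derivative (\<lambda>v. \<Sum>b\<in>Basis. (?f v x \<bullet> b) *\<^sub>R ?g b (f x))) (at x)"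
    if x: "x \<in> S" for x
  proof -
    have g: "(g has_derivative frechet_derivative g (at (f x))) (at (f x))"
      using Ck_on_has_derivative[OF Suc.prems(1)] x assms by blast
    have chain: "((\<lambda>x. g (f x)) has_derivative (\<lambda>v. frechet_derivative g (at (f x)) (?f v x))) (at x)"
      using diff_chain_at[OF Ck_on_has_derivative[OF Suc.prems(2) x] g] by (simp add: o_def)
    have rep: "frechet_derivative g (at (f x)) w = (\<Sum>b\<in>Basis. (w \<bullet> b) *\<^sub>R ?g b (f x))" for w
    proof -
      interpret linear "frechet_derivative g (at (f x))"
        using g by (rule has_derivative_linear)
      show ?thesis
        by (subst euclidean_representation[of w, symmetric]) (simp only: sum scale)
    qed
    have "(\<lambda>v. frechet_derivative g (at (f x)) (?f v x)) = (\<lambda>v. \<Sum>b\<in>Basis. (?f v x \<bullet> b) *\<^sub>R ?g b (f x))"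
      by (rule ext, rule rep)
    then show ?thesis by (rule has_derivative_eq_rhs[OF chain])
  qed
  moreover have "Ck_on k S (\<lambda>x. \<Sum>b\<in>Basis. (?f v x \<bullet> b) *\<^sub>R ?g b (f x))" for v
  proof (intro Ck_on_sum Ck_on_scaleR \<open>open S\<close>)
    fix b :: 'u
    show "Ck_on k S (\<lambda>x. ?f v x \<bullet> b)"
      using Suc.prems(2) by (intro Ck_on_linear[OF bounded_linear_inner_left \<open>open S\<close>]) simp
    show "Ck_on k S (\<lambda>x. ?g b (f x))"
      using Suc.prems(1) f by (auto intro: Suc.IH[of "?g b"])
  qed simp_all
  ultimately show ?case
    by (intro Ck_on_Suc_intro[where f'="\<lambda>x v. \<Sum>b\<in>Basis. (?f v x \<bullet> b) *\<^sub>R ?g b (f x)"])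
       (auto simp: \<open>open S\<close>)
qed

section \<open>Smooth bump functions\<close>

text \<open>The functions \<open>t\<^sup>-\<^sup>n exp (-1/t)\<close>, extended by 0 to \<open>t \<le> 0\<close>. Their linear span is closed under
  differentiation, so that differentiability of each of them already gives smoothness.\<close>

definition flat :: "nat \<Rightarrow> real \<Rightarrow> real" where
  "flat n t = (if t > 0 then exp (- 1 / t) / t ^ n else 0)"

lemma flat_has_derivative:
  "(flat n has_real_derivative flat (n + 2) t - real n * flat (n + 1) t) (at t)"
proof -
  consider "t > 0" | "t < 0" | "t = 0" by linarith
  then show ?thesis
  proof cases
    case 1
    have "((\<lambda>t. exp (- 1 / t) / t ^ n) has_real_derivative flat (n + 2) t - real n * flat (n + 1) t) (at t)"
      using 1 unfolding flat_def
      by (cases n; auto intro!: derivative_eq_intros simp: field_simps power2_eq_square;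
          metis One_nat_def power_eq_if)
    then show ?thesis
      by (rule has_field_derivative_transform_within_open[where S="{0<..}"])
         (use 1 in \<open>auto simp: flat_def\<close>)
  next
    case 2
    have "((\<lambda>t. 0) has_real_derivative 0) (at t)" by simp
    then have "(flat n has_real_derivative 0) (at t)"
      by (rule has_field_derivative_transform_within_open[where S="{..<0}"])
         (use 2 in \<open>auto simp: flat_def\<close>)
    then show ?thesis using 2 by (simp add: flat_def)
  next
    case 3
    \<comment> \<open>The difference quotient of \<open>flat n\<close> at 0 is \<open>flat (n + 1)\<close>.\<close>
    have "((\<lambda>t::real. exp (- 1 / t) / t ^ (n + 1)) \<longlongrightarrow> 0) (at_right 0)"
      by real_asymp
    then have "(flat (n + 1) \<longlongrightarrow> 0) (at_right 0)"
      by (rule Lim_transform_eventually)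
         (auto simp: flat_def eventually_at_right_less
            intro!: eventually_mono[OF eventually_at_right_less])
    moreover have "(flat (n + 1) \<longlongrightarrow> 0) (at_left 0)"
      by (rule tendsto_eventually)
         (auto simp: flat_def eventually_at_left_field intro!: exI[of _ "-1"])
    ultimately have "(flat (n + 1) \<longlongrightarrow> 0) (at 0)"
      by (simp add: filterlim_split_at)
    moreover have "flat (n + 1) = (\<lambda>t. flat n t / t)"
      by (auto simp: flat_def)
    ultimately show ?thesis
      using 3 by (simp add: DERIV_def flat_def)
  qed
qed

lemma Ck_on_flat: "Ck_on k UNIV (flat n)"
proof (induction k arbitrary: n)
  case 0
  then show ?case
    using DERIV_continuous[OF flat_has_derivative] by (auto simp: continuous_on_eq_continuous_at)
next
  case (Suc k)
  show ?case
  proof (rule Ck_on_Suc_intro)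
    show "(flat n has_derivative (\<lambda>v. v * (flat (n + 2) t + (- real n) * flat (n + 1) t))) (at t)" for t
      using flat_has_derivative[of n t]
      by (simp add: has_field_derivative_def mult.commute[of _ "_ - _"] mult_commute_abs)
    show "Ck_on k UNIV (\<lambda>t. v * (flat (n + 2) t + (- real n) * flat (n + 1) t))" for v
      by (intro Ck_on_linear[OF bounded_linear_mult_right] Ck_on_add Suc.IH open_UNIV)
  qed simp_all
qed

text \<open>The function \<open>z \<mapsto> flat 0 (r\<^sup>2 - \<bar>z - c\<bar>\<^sup>2)\<close>, normalised at the centre.\<close>

lemma smooth_bump_exists:
  fixes c :: "'e::euclidean_space"
  assumes "r > 0"
  obtains b :: "'e \<Rightarrow> real"
  where "\<And>k. Ck_on k UNIV b" "b c = 1" "\<And>z. z \<notin> cball c r \<Longrightarrow> b z = 0"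
proof -
  define N where "N z = r\<^sup>2 + - ((z - c) \<bullet> (z - c))" for z
  have N: "Ck_on k UNIV N" for k
  proof (cases k)
    case 0
    then show ?thesis by (auto simp: N_def intro!: continuous_intros)
  next
    case (Suc j)
    show ?thesis unfolding Suc
    proof (rule Ck_on_Suc_intro)
      show "(N has_derivative (\<lambda>v. z \<bullet> (-2 *\<^sub>R v) + 2 * (c \<bullet> v))) (at z)" for z
        unfolding N_def by (auto intro!: derivative_eq_intros simp: inner_commute algebra_simps)
      show "Ck_on j UNIV (\<lambda>z. z \<bullet> (-2 *\<^sub>R v) + 2 * (c \<bullet> v))" for v
        by (intro Ck_on_add Ck_on_const Ck_on_linear[OF bounded_linear_inner_left] Ck_on_id open_UNIV)
    qed simp_all
  qed
  define b where "b z = inverse (flat 0 (r\<^sup>2)) * flat 0 (N z)" for z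
  show ?thesis
  proof (rule that[of b])
    show "Ck_on k UNIV b" for k
      unfolding b_def
      by (intro Ck_on_linear[OF bounded_linear_mult_right] Ck_on_compose[OF _ _ Ck_on_flat N]) auto
    show "b c = 1" using \<open>r > 0\<close> by (simp add: b_def N_def flat_def)
    show "b z = 0" if "z \<notin> cball c r" for z
    proof -
      have "r < norm (z - c)" using that by (simp add: dist_norm norm_minus_commute)
      then have "r\<^sup>2 \<le> (norm (z - c))\<^sup>2" using \<open>r > 0\<close> by (intro power_mono) auto
      then show ?thesis by (simp add: b_def N_def flat_def dot_square_norm)
    qed
  qed
qed

section \<open>Tangent vectors in coordinates\<close>

lemma smooth_on_has_derivative:
  "smooth_on S f \<Longrightarrow> x \<in> S \<Longrightarrow> (f has_derivative frechet_derivative f (at x)) (at x)"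
  using Ck_on_has_derivative[of 0 S f x] unfolding smooth_on_def by blast

lemma smooth_on_compose:
  fixes f :: "'v::real_normed_vector \<Rightarrow> 'u::euclidean_space"
  shows "smooth_on T g \<Longrightarrow> smooth_on S f \<Longrightarrow> f ` S \<subseteq> T \<Longrightarrow> smooth_on S (g \<circ> f)"
  unfolding smooth_on_def using Ck_on_compose[of S f T _ g] by (auto simp: o_def)

lemma smooth_on_cong: "smooth_on S g \<Longrightarrow> (\<And>x. x \<in> S \<Longrightarrow> f x = g x) \<Longrightarrow> smooth_on S f"
  unfolding smooth_on_def using Ck_on_cong[of S f g] by blast

lemma smooth_on_Un: "smooth_on S f \<Longrightarrow> smooth_on T f \<Longrightarrow> smooth_on (S \<union> T) f"
  unfolding smooth_on_def using Ck_on_Un by blast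

locale smooth_manifold =
  fixes A :: "('a::{t2_space,second_countable_topology}, 'e::euclidean_space) chart set"
  assumes smooth: "smooth_atlas A"
begin

lemma chart_at: obtains U x where "(U, x) \<in> A" "p \<in> U"
proof -
  have "p \<in> (\<Union>(U, x)\<in>A. U)" using smooth by (simp add: smooth_atlas_def)
  then show ?thesis using that by blast
qed

lemma chart_facts:
  assumes "(U, x) \<in> A"
  shows "open U" "open (x ` U)" "continuous_on (x ` U) (inv_into U x)"
    "\<And>q. q \<in> U \<Longrightarrow> inv_into U x (x q) = q"
proof -
  have "is_chart (U, x)" using assms smooth unfolding smooth_atlas_def by blast
  then have h: "open U" "open (x ` U)" "homeomorphism U (x ` U) x (inv_into U x)"
    by (auto simp: is_chart_def)
  show "open U" "open (x ` U)" by fact+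
  show "continuous_on (x ` U) (inv_into U x)"
    using h(3) by (auto simp: homeomorphism_def)
  show "inv_into U x (x q) = q" if "q \<in> U" for q
    using h(3) that by (auto simp: homeomorphism_def)
qed

lemma open_chart_image:
  assumes "(U, x) \<in> A" "open W" "W \<subseteq> U"
  shows "open (x ` W)"
proof -
  note c = chart_facts[OF assms(1)]
  have "x ` W = x ` U \<inter> inv_into U x -` W"
    using assms(3) c(4) by (force simp: image_iff)
  then show ?thesis
    using continuous_open_preimage[OF c(3) c(2) assms(2)] by simp
qed

lemma transition_smooth:
  "(U, x) \<in> A \<Longrightarrow> (V, y) \<in> A \<Longrightarrow> smooth_on (x ` (U \<inter> V)) (y \<circ> inv_into U x)"
  using smooth unfolding smooth_atlas_def by blast

lemma smooth_fun_in_chart: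
  "smooth_fun A f \<Longrightarrow> (U, x) \<in> A \<Longrightarrow> smooth_on (x ` U) (f \<circ> inv_into U x)"
  unfolding smooth_fun_def by blast

text \<open>The tangent vector at \<open>q\<close> whose coordinates in the chart \<open>(U, x)\<close> are \<open>w\<close>. As for velocities,
  the value on functions that are not smooth is 0, so that the two notions can be equal as
  operators.\<close>

definition coord_vector :: "'a set \<Rightarrow> ('a \<Rightarrow> 'e) \<Rightarrow> 'a \<Rightarrow> 'e \<Rightarrow> 'a tangent" where
  "coord_vector U x q w =
     (\<lambda>f. if smooth_fun A f then frechet_derivative (f \<circ> inv_into U x) (at (x q)) w else 0)"

lemma coord_vector_linear:
  assumes "(U, x) \<in> A" "q \<in> U"
  shows "coord_vector U x q (v + w) = coord_vector U x q v + coord_vector U x q w"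
    and "coord_vector U x q (c *\<^sub>R w) = tscale c (coord_vector U x q w)"
proof -
  have l: "linear (frechet_derivative (f \<circ> inv_into U x) (at (x q)))" if "smooth_fun A f" for f
    using smooth_on_has_derivative[OF smooth_fun_in_chart[OF that assms(1)]] assms(2)
    by (intro has_derivative_linear) auto
  show "coord_vector U x q (v + w) = coord_vector U x q v + coord_vector U x q w"
    "coord_vector U x q (c *\<^sub>R w) = tscale c (coord_vector U x q w)"
    by (auto simp: coord_vector_def tscale_def fun_eq_iff linear_add[OF l] linear_scale[OF l])
qed

lemma chain_rule_along_curve:
  assumes c: "(U, x) \<in> A" "\<gamma> t \<in> U" and cont: "isCont \<gamma> t"
    and d: "((x \<circ> \<gamma>) has_vector_derivative w) (at t)" and f: "smooth_fun A f"
  shows "((f \<circ> \<gamma>) has_real_derivative coord_vector U x (\<gamma> t) w f) (at t)"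
proof -
  let ?F = "f \<circ> inv_into U x"
  have "(?F has_derivative frechet_derivative ?F (at ((x \<circ> \<gamma>) t))) (at ((x \<circ> \<gamma>) t))"
    using smooth_on_has_derivative[OF smooth_fun_in_chart[OF f c(1)]] c(2) by auto
  from vector_derivative_diff_chain_within[OF d has_derivative_at_withinI[OF this]]
  have d': "((?F \<circ> (x \<circ> \<gamma>)) has_vector_derivative coord_vector U x (\<gamma> t) w f) (at t)"
    by (simp add: coord_vector_def f o_def)
  have "\<forall>\<^sub>F s in nhds t. \<gamma> s \<in> U"
    using cont chart_facts(1)[OF c(1)] c(2)
    by (simp add: isCont_def tendsto_at_iff_tendsto_nhds topological_tendstoD)
  then obtain T where T: "open T" "t \<in> T" "\<And>s. s \<in> T \<Longrightarrow> \<gamma> s \<in> U"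
    unfolding eventually_nhds by blast
  show ?thesis
    unfolding has_real_derivative_iff_has_vector_derivative
    by (rule has_vector_derivative_transform_within_open[OF d' T(1,2)])
       (simp add: T(3) chart_facts(4)[OF c(1)])
qed

lemma velocity_coord:
  assumes "(U, x) \<in> A" "\<gamma> 0 \<in> U" "isCont \<gamma> 0" "((x \<circ> \<gamma>) has_vector_derivative w) (at 0)"
  shows "velocity A \<gamma> = coord_vector U x (\<gamma> 0) w"
proof
  fix f
  show "velocity A \<gamma> f = coord_vector U x (\<gamma> 0) w f"
  proof (cases "smooth_fun A f")
    case True
    then show ?thesis
      using DERIV_imp_deriv[OF chain_rule_along_curve[where \<gamma>=\<gamma>, OF assms True]] by (simp add: velocity_def)
  qed (simp add: velocity_def coord_vector_def)
qed

text \<open>A coordinate line is smooth in every chart since the transition maps are smooth.\<close>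

lemma smooth_curve_line:
  fixes c :: 'e
  assumes c: "(U, x) \<in> A" and e: "e > 0" and line: "\<And>t. \<bar>t\<bar> < e \<Longrightarrow> a + t *\<^sub>R w \<in> x ` U"
  shows "smooth_curve A e (\<lambda>t. inv_into U x (a + t *\<^sub>R w))"
proof -
  let ?\<gamma> = "\<lambda>t. inv_into U x (a + t *\<^sub>R w)" and ?l = "\<lambda>t. a + t *\<^sub>R w"
  have cont: "continuous_on {-e<..<e} ?\<gamma>"
    by (rule continuous_on_compose2[OF chart_facts(3)[OF c]])
       (auto intro!: continuous_intros line)
  have "smooth_on ({-e<..<e} \<inter> ?\<gamma> -` V) (y \<circ> ?\<gamma>)" if V: "(V, y) \<in> A" for V y
  proof -
    let ?S = "{-e<..<e} \<inter> ?\<gamma> -` V"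
    have "open ?S"
      using continuous_open_preimage[OF cont _ chart_facts(1)[OF V]] by simp
    moreover have "Ck_on k ?S ?l" for k
      by (intro Ck_on_add Ck_on_const Ck_on_linear[OF bounded_linear_scaleR_left] Ck_on_id \<open>open ?S\<close>)
    ultimately have "smooth_on ?S ?l" by (simp add: smooth_on_def)
    moreover have "?l ` ?S \<subseteq> x ` (U \<inter> V)"
    proof
      fix z assume "z \<in> ?l ` ?S"
      then obtain t where t: "\<bar>t\<bar> < e" "inv_into U x z \<in> V" "z = ?l t"
        by force
      from line[OF t(1)] obtain q where "q \<in> U" "z = x q" using t(3) by auto
      then show "z \<in> x ` (U \<inter> V)" using t(2) chart_facts(4)[OF c] by auto
    qed
    ultimately show ?thesis
      using smooth_on_compose[OF transition_smooth[OF c V]] by (simp add: o_def)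
  qed
  then show ?thesis using cont by (auto simp: smooth_curve_def)
qed

lemma coord_vector_in_tangent_space:
  assumes c: "(U, x) \<in> A" and q: "q \<in> U"
  shows "coord_vector U x q w \<in> tangent_space A q"
proof -
  obtain r where r: "r > 0" "ball (x q) r \<subseteq> x ` U"
    using chart_facts(2)[OF c] q open_contains_ball by blast
  \<comment> \<open>The summand 1 covers the case \<open>w = 0\<close>.\<close>
  define e where "e = r / (norm w + 1)"
  have e: "e > 0" using r by (simp add: e_def add_nonneg_pos)
  have line: "x q + t *\<^sub>R w \<in> x ` U" if "\<bar>t\<bar> < e" for t
  proof -
    have "\<bar>t\<bar> * norm w \<le> \<bar>t\<bar> * (norm w + 1)" by (simp add: mult_left_mono)
    also have "\<dots> < r" using that by (simp add: e_def pos_less_divide_eq add_nonneg_pos)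
    finally show ?thesis using r(2) by (auto simp: dist_norm)
  qed
  let ?\<gamma> = "\<lambda>t. inv_into U x (x q + t *\<^sub>R w)"
  have sc: "smooth_curve A e ?\<gamma>" by (rule smooth_curve_line[OF c e line])
  have g0: "?\<gamma> 0 = q" using chart_facts(4)[OF c q] by simp
  have "isCont ?\<gamma> 0"
    using sc e by (auto simp: smooth_curve_def continuous_on_eq_continuous_at)
  moreover have "((x \<circ> ?\<gamma>) has_vector_derivative w) (at 0)"
  proof (rule has_vector_derivative_transform_within_open[of "\<lambda>t. x q + t *\<^sub>R w" _ _ "{-e<..<e}"])
    show "((\<lambda>t. x q + t *\<^sub>R w) has_vector_derivative w) (at 0)"
      by (auto intro!: derivative_eq_intros)
  qed (use e line in \<open>auto simp: f_inv_into_f\<close>)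
  ultimately have "velocity A ?\<gamma> = coord_vector U x q w"
    using velocity_coord[OF c, of ?\<gamma> w] q g0 by simp
  then show ?thesis
    using sc e g0 unfolding tangent_space_def mem_Collect_eq
    by (intro exI[of _ ?\<gamma>] exI[of _ e]) simp
qed

text \<open>Velocities of curves are determined by their derivatives in coordinates, and every derivative is
  attained by a coordinate line. In particular the tangent space, which is defined as a mere set of
  velocities, is a vector space.\<close>

lemma tangent_space_coord:
  assumes c: "(U, x) \<in> A" and q: "q \<in> U"
  shows "tangent_space A q = range (coord_vector U x q)"
proof
  show "range (coord_vector U x q) \<subseteq> tangent_space A q"
    using coord_vector_in_tangent_space[OF assms] by blast
  show "tangent_space A q \<subseteq> range (coord_vector U x q)"
  proof
    fix u assume "u \<in> tangent_space A q"
    then obtain \<gamma> e where g: "e > 0" "smooth_curve A e \<gamma>" "\<gamma> 0 = q" "u = velocity A \<gamma>"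
      unfolding tangent_space_def by blast
    have "isCont \<gamma> 0"
      using g by (auto simp: smooth_curve_def continuous_on_eq_continuous_at)
    moreover
    have "smooth_on ({-e<..<e} \<inter> \<gamma> -` U) (x \<circ> \<gamma>)"
      using g(2) c by (auto simp: smooth_curve_def)
    from smooth_on_has_derivative[OF this, of 0]
    have "((x \<circ> \<gamma>) has_derivative frechet_derivative (x \<circ> \<gamma>) (at 0)) (at 0)"
      using g q by simp
    then have "((x \<circ> \<gamma>) has_vector_derivative vector_derivative (x \<circ> \<gamma>) (at 0)) (at 0)"
      by (auto simp: differentiable_def simp flip: vector_derivative_works)
    ultimately show "u \<in> range (coord_vector U x q)"
      using velocity_coord[OF c] q g by auto
  qed
qed

lemma tangent_space_add:
    "u \<in> tangent_space A p \<Longrightarrow> v \<in> tangent_space A p \<Longrightarrow> u + v \<in> tangent_space A p"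
  and tangent_space_scale:
    "u \<in> tangent_space A p \<Longrightarrow> tscale r u \<in> tangent_space A p"
proof -
  obtain U x where c: "(U, x) \<in> A" "p \<in> U" by (rule chart_at)
  show "u \<in> tangent_space A p \<Longrightarrow> v \<in> tangent_space A p \<Longrightarrow> u + v \<in> tangent_space A p"
    "u \<in> tangent_space A p \<Longrightarrow> tscale r u \<in> tangent_space A p"
    unfolding tangent_space_coord[OF c]
    by (auto simp only: image_iff coord_vector_linear[OF c, symmetric] intro: rangeI)
qed

text \<open>Every tangent vector extends to a global smooth vector field. This is what makes identities
  between tensors, which are assumed for vector fields, available for single tangent vectors.
  The extension is the vector field with constant coordinates in a chart, cut off by a bump
  function with support in a compact part \<open>C\<close> of the chart domain. Its smoothness is checked
  separately on the chart domain and on the complement of \<open>C\<close>, which is open since the manifold is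
  Hausdorff.\<close>

lemma vector_field_through:
  assumes u: "u \<in> tangent_space A p"
  obtains X where "X \<in> vfields A" "X p = u"
proof -
  obtain U x where c: "(U, x) \<in> A" "p \<in> U" by (rule chart_at)
  obtain w where w: "u = coord_vector U x p w" using u tangent_space_coord[OF c] by blast
  obtain r where r: "r > 0" "cball (x p) r \<subseteq> x ` U"
    using chart_facts(2)[OF c(1)] c(2) open_contains_cball by blast
  obtain b :: "'e \<Rightarrow> real" where b: "\<And>k. Ck_on k UNIV b" "b (x p) = 1"
      "\<And>z. z \<notin> cball (x p) r \<Longrightarrow> b z = 0"
    using smooth_bump_exists[OF r(1), of "x p"] by metis
  define C where "C = inv_into U x ` cball (x p) r"
  have "compact C" unfolding C_def
    by (rule compact_continuous_image[OF continuous_on_subset[OF chart_facts(3)[OF c(1)] r(2)]]) simp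
  then have "closed C" by (rule compact_imp_closed)
  have C_sub: "C \<subseteq> U" unfolding C_def using r(2) by (auto intro: inv_into_into)
  have b0: "b (x q) = 0" if "q \<in> U" "q \<notin> C" for q
  proof (rule b(3), rule notI)
    assume "x q \<in> cball (x p) r"
    then have "inv_into U x (x q) \<in> C" by (simp add: C_def)
    then show False using that chart_facts(4)[OF c(1)] by simp
  qed
  define X where "X q = (if q \<in> U then tscale (b (x q)) (coord_vector U x q w) else 0)" for q
  have X_tan: "X q \<in> tangent_space A q" for q
  proof (cases "q \<in> U")
    case True
    then show ?thesis
      using tangent_space_scale coord_vector_in_tangent_space[OF c(1)] by (simp add: X_def)
  next
    case False
    obtain V y where "(V, y) \<in> A" "q \<in> V" by (rule chart_at)
    then have "tscale 0 (coord_vector V y q w) \<in> tangent_space A q"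
      using tangent_space_scale coord_vector_in_tangent_space by blast
    moreover have "tscale 0 v = 0" for v :: "'a tangent" by (rule tan.scale_zero_left)
    ultimately show ?thesis using False by (simp add: X_def)
  qed
  have "smooth_fun A (dfun X f)" if f: "smooth_fun A f" for f
    unfolding smooth_fun_def
  proof clarify
    fix V y assume V: "(V, y) \<in> A"
    let ?h = "dfun X f \<circ> inv_into V y"
    define F where "F z = b z *\<^sub>R frechet_derivative (f \<circ> inv_into U x) (at z) w" for z
    have "Ck_on (Suc k) (x ` U) (f \<circ> inv_into U x)" for k
      using smooth_fun_in_chart[OF f c(1)] unfolding smooth_on_def by blast
    then have "Ck_on k (x ` U) (\<lambda>z. frechet_derivative (f \<circ> inv_into U x) (at z) w)" for k
      by simp
    then have F: "smooth_on (x ` U) F"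
      unfolding smooth_on_def F_def using chart_facts(2)[OF c(1)]
      by (intro conjI allI Ck_on_scaleR Ck_on_subset[OF b(1)]) auto
    have "smooth_on (y ` (V \<inter> U)) (F \<circ> (x \<circ> inv_into V y))"
      by (rule smooth_on_compose[OF F transition_smooth[OF V c(1)]])
         (auto simp: chart_facts(4)[OF V])
    then have "smooth_on (y ` (V \<inter> U)) ?h"
      by (rule smooth_on_cong)
         (auto simp: chart_facts(4)[OF V] dfun_def X_def F_def tscale_def coord_vector_def f)
    moreover have "smooth_on (y ` (V - C)) ?h"
    proof (rule smooth_on_cong[of _ "\<lambda>_. 0"])
      have "open (V - C)" using chart_facts(1)[OF V] \<open>closed C\<close> by blast
      then show "smooth_on (y ` (V - C)) (\<lambda>_. 0::real)"
        using open_chart_image[OF V] Ck_on_const by (auto simp: smooth_on_def)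
    qed (auto simp: chart_facts(4)[OF V] dfun_def X_def tscale_def b0)
    ultimately have "smooth_on (y ` (V \<inter> U) \<union> y ` (V - C)) ?h"
      by (rule smooth_on_Un)
    moreover have "y ` (V \<inter> U) \<union> y ` (V - C) = y ` V"
      using C_sub by blast
    ultimately show "smooth_on (y ` V) ?h" by simp
  qed
  then have "X \<in> vfields A" using X_tan by (simp add: vfields_def)
  moreover have "X p = u" using c(2) b(2) w by (simp add: X_def)
  ultimately show ?thesis by (rule that)
qed

text \<open>The value of \<open>deriv\<close> is unspecified where a function is not differentiable, so negation is
  moved through the Frechet derivative of a smooth function, which represents \<open>X p\<close> in coordinates.\<close>

lemma dfun_uminus:
  assumes "X \<in> vfields A" "smooth_fun A f"
  shows "dfun X (\<lambda>q. - f q) p = - dfun X f p"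
proof -
  obtain U x where c: "(U, x) \<in> A" "p \<in> U" by (rule chart_at)
  obtain w where w: "X p = coord_vector U x p w"
    using assms(1) tangent_space_coord[OF c] unfolding vfields_def by blast
  let ?F = "f \<circ> inv_into U x"
  have neg: "smooth_fun A (\<lambda>q. - f q)"
    using assms(2) Ck_on_linear[OF bounded_linear_minus[OF bounded_linear_ident]]
    by (fastforce simp: smooth_fun_def smooth_on_def o_def)
  have "(?F has_derivative frechet_derivative ?F (at (x p))) (at (x p))"
    using smooth_on_has_derivative[OF smooth_fun_in_chart[OF assms(2) c(1)]] c(2) by auto
  then have "((\<lambda>z. - ?F z) has_derivative (\<lambda>v. - frechet_derivative ?F (at (x p)) v)) (at (x p))"
    by (rule has_derivative_minus)
  then have "frechet_derivative ((\<lambda>q. - f q) \<circ> inv_into U x) (at (x p)) w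
      = - frechet_derivative ?F (at (x p)) w"
    by (simp add: frechet_derivative_at[symmetric] o_def)
  then show ?thesis by (simp add: dfun_def w coord_vector_def neg assms(2))
qed

end

section \<open>Almost contact metric algebra\<close>

context almost_contact_metric_manifold
begin

sublocale smooth_manifold A
  by unfold_locales (rule atlas)

lemma phi_tangent:
  "u \<in> tangent_space A p \<Longrightarrow> \<phi> p u \<in> tangent_space A p"
  "u \<in> tangent_space A p \<Longrightarrow> v \<in> tangent_space A p \<Longrightarrow> \<phi> p (u + v) = \<phi> p u + \<phi> p v"
  "u \<in> tangent_space A p \<Longrightarrow> \<phi> p (tscale c u) = tscale c (\<phi> p u)"
  using phi_tensor unfolding tensor11_def by blast+

lemma eta_scale: "u \<in> tangent_space A p \<Longrightarrow> \<eta> p (tscale c u) = c * \<eta> p u"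
  using eta_form unfolding one_form_def by blast

lemma g_tangent:
  "u \<in> tangent_space A p \<Longrightarrow> v \<in> tangent_space A p \<Longrightarrow> w \<in> tangent_space A p \<Longrightarrow>
     g p (u + v) w = g p u w + g p v w"
  "u \<in> tangent_space A p \<Longrightarrow> v \<in> tangent_space A p \<Longrightarrow> g p (tscale c u) v = c * g p u v"
  "u \<in> tangent_space A p \<Longrightarrow> v \<in> tangent_space A p \<Longrightarrow> g p u v = g p v u"
  "u \<in> tangent_space A p \<Longrightarrow> u \<noteq> 0 \<Longrightarrow> g p u u > 0"
  using metric unfolding riemannian_metric_def by blast+

lemma xi_tangent: "\<xi> p \<in> tangent_space A p"
  using xi_vfield unfolding vfields_def by blast

lemma vfield_tangent: "X \<in> vfields A \<Longrightarrow> X p \<in> tangent_space A p"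
  unfolding vfields_def by blast

lemma zero_tangent: "0 \<in> tangent_space A p"
  using tangent_space_scale[OF xi_tangent, of 0] by simp

lemma uminus_tscale: "- u = tscale (-1) u"
  by (simp add: tan.scale_minus_left)

lemma uminus_tangent: "u \<in> tangent_space A p \<Longrightarrow> - u \<in> tangent_space A p"
  unfolding uminus_tscale by (rule tangent_space_scale)

lemma phi_zero: "\<phi> p 0 = 0"
  using phi_tangent(3)[OF zero_tangent, of p 0] by simp

lemma phi_uminus: "u \<in> tangent_space A p \<Longrightarrow> \<phi> p (- u) = - \<phi> p u"
  unfolding uminus_tscale by (rule phi_tangent(3))

lemma g_zero: "u \<in> tangent_space A p \<Longrightarrow> g p 0 u = 0"
  using g_tangent(2)[OF zero_tangent, of u p 0] by simp

lemma g_uminus: "u \<in> tangent_space A p \<Longrightarrow> v \<in> tangent_space A p \<Longrightarrow> g p (- u) v = - g p u v"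
  using g_tangent(2)[of u p v "-1"] by (simp flip: uminus_tscale)

lemma g_phi_tangent:
  assumes "u \<in> tangent_space A p" "v \<in> tangent_space A p"
  shows "g p (\<phi> p u) (\<phi> p v) = g p u v - \<eta> p u * \<eta> p v"
proof -
  obtain X where "X \<in> vfields A" "X p = u" using assms(1) by (rule vector_field_through)
  moreover obtain Y where "Y \<in> vfields A" "Y p = v" using assms(2) by (rule vector_field_through)
  ultimately show ?thesis using g_phi[of X Y p] by simp
qed

text \<open>Computing \<open>\<phi>\<^sup>3 \<xi>\<close> in two ways gives \<open>\<phi>\<xi> = a\<xi>\<close> with \<open>a = \<eta>(\<phi>\<xi>)\<close>; applying \<open>\<phi>\<close> once more gives
  \<open>a \<phi>\<xi> = \<phi>\<^sup>2 \<xi> = 0\<close>, and in either case \<open>\<phi>\<xi> = 0\<close>.\<close>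

lemma phi_xi: "\<phi> p (\<xi> p) = 0"
proof -
  let ?a = "\<eta> p (\<phi> p (\<xi> p))"
  have sq: "\<phi> p (\<phi> p (\<xi> p)) = 0"
    using phi_sq[OF xi_tangent] eta_xi by simp
  have "\<phi> p (\<phi> p (\<phi> p (\<xi> p))) = - \<phi> p (\<xi> p) + tscale ?a (\<xi> p)"
    by (rule phi_sq[OF phi_tangent(1)[OF xi_tangent]])
  then have eq: "\<phi> p (\<xi> p) = tscale ?a (\<xi> p)"
    unfolding sq phi_zero by (simp add: eq_neg_iff_add_eq_0 neg_eq_iff_add_eq_0 add.commute)
  have "tscale ?a (\<phi> p (\<xi> p)) = 0"
    using sq phi_tangent(3)[OF xi_tangent, of p ?a] eq by simp
  then show ?thesis
    using eq by auto
qed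

lemma eta_eq_g_xi: "u \<in> tangent_space A p \<Longrightarrow> \<eta> p u = g p u (\<xi> p)"
  using g_phi_tangent[OF _ xi_tangent, of u p] g_tangent(3)[OF zero_tangent phi_tangent(1)[of u p]]
  by (simp add: phi_xi eta_xi g_zero phi_tangent(1))

text \<open>Compare the two ways \<open>\<phi>(\<phi>\<^sup>2 u) = \<phi>\<^sup>2(\<phi>u)\<close> of expanding \<open>\<phi>\<^sup>3 u\<close>.\<close>

lemma eta_phi:
  assumes u: "u \<in> tangent_space A p"
  shows "\<eta> p (\<phi> p u) = 0"
proof -
  have "\<phi> p (\<phi> p (\<phi> p u)) = - \<phi> p u"
    unfolding phi_sq[OF u]
    by (simp add: phi_tangent(2,3) uminus_tangent u tangent_space_scale xi_tangent phi_uminus phi_xi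
        del: uminus_add_conv_diff)
  then have "tscale (\<eta> p (\<phi> p u)) (\<xi> p) = 0"
    using phi_sq[OF phi_tangent(1)[OF u]] by simp
  moreover have "\<xi> p \<noteq> 0"
    using eta_xi[of p] eta_scale[OF zero_tangent, of p 0] by auto
  ultimately show ?thesis by simp
qed

text \<open>Replace \<open>v\<close> by \<open>\<phi>v\<close> in the compatibility of \<open>g\<close> with \<open>\<phi>\<close>; the terms with \<open>\<eta>\<close> vanish because
  \<open>\<eta> \<circ> \<phi> = 0\<close>.\<close>

lemma phi_skew:
  assumes u: "u \<in> tangent_space A p" and v: "v \<in> tangent_space A p"
  shows "g p (\<phi> p u) v = - g p u (\<phi> p v)"
proof -
  note t = u v xi_tangent phi_tangent(1)[OF u] phi_tangent(1)[OF v]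
  have "g p u (\<phi> p v) = g p (\<phi> p u) (\<phi> p (\<phi> p v))"
    using g_phi_tangent[OF u t(5)] eta_phi[OF v] by simp
  also have "\<dots> = g p (- v + tscale (\<eta> p v) (\<xi> p)) (\<phi> p u)"
    using g_tangent(3)[OF t(4) phi_tangent(1)[OF t(5)]] phi_sq[OF v] by simp
  also have "\<dots> = - g p v (\<phi> p u) + \<eta> p v * g p (\<xi> p) (\<phi> p u)"
    by (simp add: g_tangent(1,2) g_uminus uminus_tangent t tangent_space_scale
        del: uminus_add_conv_diff)
  also have "g p (\<xi> p) (\<phi> p u) = 0"
    using g_tangent(3)[OF t(3,4)] eta_eq_g_xi[OF t(4)] eta_phi[OF u] by simp
  finally show ?thesis using g_tangent(3)[OF v t(4)] by simp
qed

end

section \<open>The difference tensor\<close>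

context almost_contact_statistical_manifold
begin

lemma K_tangent:
  "u \<in> tangent_space A p \<Longrightarrow> v \<in> tangent_space A p \<Longrightarrow> K p u v \<in> tangent_space A p"
  using K_tensor unfolding tensor12_def by blast

lemma K_zero: "u \<in> tangent_space A p \<Longrightarrow> K p u 0 = 0"
  using K_tensor zero_tangent[of p] unfolding tensor12_def by (metis tan.scale_zero_left)

lemma K_phi_tangent:
  assumes "u \<in> tangent_space A p" "v \<in> tangent_space A p"
  shows "K p u (\<phi> p v) = - \<phi> p (K p u v)"
proof -
  obtain X where "X \<in> vfields A" "X p = u" using assms(1) by (rule vector_field_through)
  moreover obtain Y where "Y \<in> vfields A" "Y p = v" using assms(2) by (rule vector_field_through)
  ultimately show ?thesis
    using fun_cong[OF K_phi[of X Y], of p] by (simp add: apply11_def apply12_def eq_neg_iff_add_eq_0)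
qed

lemma D_vfield: "X \<in> vfields A \<Longrightarrow> Y \<in> vfields A \<Longrightarrow> D X Y \<in> vfields A"
  and D0_vfield: "X \<in> vfields A \<Longrightarrow> Y \<in> vfields A \<Longrightarrow> D0 X Y \<in> vfields A"
  using LC stat
  by (simp_all add: levi_civita_def statistical_structure_def affine_connection_def)

lemma phi_vfield: "X \<in> vfields A \<Longrightarrow> apply11 \<phi> X \<in> vfields A"
  using phi_tensor unfolding tensor11_def by blast

lemma D_at:
  "X \<in> vfields A \<Longrightarrow> Y \<in> vfields A \<Longrightarrow> D X Y p = D0 X Y p + K p (X p) (Y p)"
  by (simp add: D_eq apply12_def)

text \<open>Both connections are torsion-free, so their difference is symmetric.\<close>

lemma K_sym:
  assumes "u \<in> tangent_space A p" "v \<in> tangent_space A p"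
  shows "K p u v = K p v u"
proof -
  obtain X where X: "X \<in> vfields A" "X p = u" using assms(1) by (rule vector_field_through)
  obtain Y where Y: "Y \<in> vfields A" "Y p = v" using assms(2) by (rule vector_field_through)
  have "D X Y - D Y X = D0 X Y - D0 Y X"
    using LC stat X Y unfolding levi_civita_def statistical_structure_def torsion_free_def by simp
  from fun_cong[OF this, of p] show ?thesis
    by (simp add: D_at X Y algebra_simps)
qed

lemma LC_at:
  assumes "X \<in> vfields A" "Y \<in> vfields A" "Z \<in> vfields A"
  shows "dfun X (metric_fun g Y Z) p = g p (D0 X Y p) (Z p) + g p (Y p) (D0 X Z p)"
proof -
  have "cov_metric D0 g X Y Z = 0"
    using LC assms unfolding levi_civita_def by blast
  from fun_cong[OF this, of p] show ?thesis
    by (simp add: cov_metric_def metric_fun_def)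
qed

text \<open>Only the \<open>K\<close> part of \<open>D\<close> contributes, since \<open>D0\<close> is metric.\<close>

lemma cov_metric_K:
  assumes "X \<in> vfields A" "Y \<in> vfields A" "Z \<in> vfields A"
  shows "cov_metric D g X Y Z p = - g p (K p (X p) (Y p)) (Z p) - g p (K p (X p) (Z p)) (Y p)"
proof -
  note t = assms[THEN vfield_tangent, of p] D0_vfield[OF assms(1), THEN vfield_tangent, of _ p]
  show ?thesis
    using LC_at[OF assms, of p] g_tangent(3)[of "Y p" p]
    by (simp add: cov_metric_def metric_fun_def D_at assms g_tangent(1) t K_tangent tangent_space_add)
qed

text \<open>Exchanging \<open>X\<close> and \<open>Y\<close> in the symmetric tensor \<open>\<nabla>g\<close> and cancelling the terms that agree by the
  symmetry of \<open>K\<close> shows that \<open>g(K(X,Z),Y)\<close> is invariant under exchanging \<open>X\<close> and \<open>Y\<close>. Together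
  with the symmetry of \<open>K\<close> this gives total symmetry.\<close>

lemma g_K_sym:
  assumes "u \<in> tangent_space A p" "v \<in> tangent_space A p" "w \<in> tangent_space A p"
  shows "g p (K p u v) w = g p (K p u w) v"
proof -
  have swap: "g p (K p a c) b = g p (K p b c) a"
    if abc: "a \<in> tangent_space A p" "b \<in> tangent_space A p" "c \<in> tangent_space A p" for a b c
  proof -
    obtain X where X: "X \<in> vfields A" "X p = a" using abc(1) by (rule vector_field_through)
    obtain Y where Y: "Y \<in> vfields A" "Y p = b" using abc(2) by (rule vector_field_through)
    obtain Z where Z: "Z \<in> vfields A" "Z p = c" using abc(3) by (rule vector_field_through)
    have "cov_metric D g X Y Z = cov_metric D g Y X Z"
      using stat X Y Z unfolding statistical_structure_def by blast
    from fun_cong[OF this, of p] show ?thesis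
      using K_sym[OF abc(1,2)] by (simp add: cov_metric_K X Y Z)
  qed
  show ?thesis
    using swap[OF assms(2,3,1)] K_sym assms by simp
qed

section \<open>Compatible statistical connections\<close>

text \<open>Put \<open>s = g(K(X,\<phi>Y),Z)\<close>. Anticommutation of \<open>K\<close> with \<open>\<phi>\<close>, skewness of \<open>\<phi>\<close>
  and total symmetry make \<open>s\<close> symmetric in \<open>Y\<close> and \<open>Z\<close>. On the other hand, \<open>\<nabla>\<phi> = 0\<close> says that
  \<open>\<nabla>\<^sup>0\<^sub>X \<phi>\<close> is \<open>-2 K(X,\<phi>\<cdot>)\<close>, and since \<open>\<phi>\<close> is skew and \<open>\<nabla>\<^sup>0\<close> is metric, this operator is skew, so
  \<open>s\<close> is also antisymmetric in \<open>Y\<close> and \<open>Z\<close>. Hence \<open>s = 0\<close>.\<close>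

lemma K_phi_zero:
  assumes par: "parallel11 A D \<phi>"
    and u: "u \<in> tangent_space A p" and v: "v \<in> tangent_space A p"
  shows "K p u (\<phi> p v) = 0"
proof -
  have orth: "g p (K p u (\<phi> p v)) w = 0" if w: "w \<in> tangent_space A p" for w
  proof -
    obtain X where X: "X \<in> vfields A" "X p = u" using u by (rule vector_field_through)
    obtain Y where Y: "Y \<in> vfields A" "Y p = v" using v by (rule vector_field_through)
    obtain Z where Z: "Z \<in> vfields A" "Z p = w" using w by (rule vector_field_through)
    note phi = phi_tangent(1)[OF v] phi_tangent(1)[OF w]
    have D0t: "D0 X W p \<in> tangent_space A p" if "W \<in> vfields A" for W
      using D0_vfield[OF X(1) that] by (rule vfield_tangent)
    \<comment> \<open>The form \<open>g(K(u,\<phi>v),w)\<close> is symmetric in \<open>v\<close> and \<open>w\<close>, and equals its variants in which \<open>\<phi>\<close>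
      sits in another place.\<close>
    let ?s = "g p (K p u (\<phi> p v)) w"
    have s1: "g p (K p u v) (\<phi> p w) = ?s"
      by (simp add: K_phi_tangent u v w g_uminus K_tangent phi_tangent(1) phi_skew)
    have s2: "g p (K p u (\<phi> p w)) v = ?s"
      using g_K_sym[OF u phi(2) v] s1 by simp
    have s3: "g p (K p u w) (\<phi> p v) = ?s"
      using g_K_sym[OF u w phi(1)] by simp
    \<comment> \<open>The condition \<open>\<nabla>\<phi> = 0\<close>, written with \<open>D0\<close> and \<open>K\<close> and paired with a vector.\<close>
    have step: "g p (D0 X (apply11 \<phi> W) p) b + g p (K p u (\<phi> p (W p))) b
        = - g p (D0 X W p) (\<phi> p b) - g p (K p u (W p)) (\<phi> p b)"
      if W: "W \<in> vfields A" and b: "b \<in> tangent_space A p" for W b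
    proof -
      have "cov_tensor11 D \<phi> X W = 0"
        using par X W unfolding parallel11_def by blast
      from fun_cong[OF this, of p]
      have "D0 X (apply11 \<phi> W) p + K p u (\<phi> p (W p)) = \<phi> p (D0 X W p + K p u (W p))"
        using D_at[OF X(1) phi_vfield[OF W], of p] D_at[OF X(1) W, of p]
        by (simp add: cov_tensor11_def apply11_def X(2))
      then have "g p (D0 X (apply11 \<phi> W) p + K p u (\<phi> p (W p))) b
          = g p (\<phi> p (D0 X W p + K p u (W p))) b" by simp
      then show ?thesis
        by (simp add: g_tangent(1) D0t W phi_vfield K_tangent u vfield_tangent phi_tangent(1) b
              phi_skew tangent_space_add)
    qed
    \<comment> \<open>Differentiating the skewness of \<open>\<phi>\<close> with the metric connection \<open>D0\<close>.\<close>
    have "metric_fun g (apply11 \<phi> Y) Z = (\<lambda>q. - metric_fun g Y (apply11 \<phi> Z) q)"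
      by (simp add: fun_eq_iff metric_fun_def apply11_def phi_skew vfield_tangent Y Z)
    moreover have "smooth_fun A (metric_fun g Y (apply11 \<phi> Z))"
      using metric Y phi_vfield[OF Z(1)] unfolding riemannian_metric_def by blast
    ultimately have "dfun X (metric_fun g (apply11 \<phi> Y) Z) p
        = - dfun X (metric_fun g Y (apply11 \<phi> Z)) p"
      using dfun_uminus[OF X(1)] by simp
    then have "g p (D0 X (apply11 \<phi> Y) p) w + g p (\<phi> p v) (D0 X Z p)
        = - g p (D0 X Y p) (\<phi> p w) - g p v (D0 X (apply11 \<phi> Z) p)"
      by (simp add: LC_at X(1) Y Z phi_vfield) (simp add: apply11_def Y Z)
    moreover have "g p (\<phi> p v) (D0 X Z p) = g p (D0 X Z p) (\<phi> p v)"
      "g p v (D0 X (apply11 \<phi> Z) p) = g p (D0 X (apply11 \<phi> Z) p) v"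
      using g_tangent(3) phi v D0t Z phi_vfield by blast+
    \<comment> \<open>The sum of the two instances of the condition carries \<open>-4s\<close>, which has to vanish.\<close>
    ultimately show ?thesis
      using step[OF Y(1) w] step[OF Z(1) v] s1 s2 s3 by (simp add: Y(2) Z(2))
  qed
  have "K p u (\<phi> p v) \<in> tangent_space A p"
    using K_tangent u v phi_tangent(1) by blast
  then show ?thesis using orth g_tangent(4) by force
qed

end

theorem theorem6p8:
  fixes A :: "('a::{t2_space,second_countable_topology}, 'e::euclidean_space) chart set"
    and \<phi> :: "'a \<Rightarrow> 'a tangent \<Rightarrow> 'a tangent"
    and \<xi> :: "'a vfield"
    and \<eta> :: "'a \<Rightarrow> 'a tangent \<Rightarrow> real"
    and g :: "'a \<Rightarrow> 'a tangent \<Rightarrow> 'a tangent \<Rightarrow> real"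
    and D D0 :: "'a connection"
    and K :: "'a \<Rightarrow> 'a tangent \<Rightarrow> 'a tangent \<Rightarrow> 'a tangent"
  assumes "almost_contact_statistical_manifold A \<phi> \<xi> \<eta> g D D0 K"
    and "parallel11 A D \<phi>"
  shows "cosymplectic_statistical_manifold A \<phi> \<xi> \<eta> g D D0 K \<and>
         (\<forall>p u. generates_phi_section A \<phi> \<xi> g p u \<longrightarrow> phi_sectional_K_curvature \<phi> g K p u = 0)"
proof -
  interpret almost_contact_statistical_manifold A \<phi> \<xi> \<eta> g D D0 K by fact
  note Kphi = K_phi_zero[OF assms(2)]
  have "cov_tensor11 D0 \<phi> X Y p = 0" if X: "X \<in> vfields A" and Y: "Y \<in> vfields A" for X Y p
  proof -
    note t = X[THEN vfield_tangent, of p] Y[THEN vfield_tangent, of p]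
    have phiK: "\<phi> p (K p (X p) (Y p)) = 0"
      using K_phi_tangent[OF t] Kphi[OF t] by simp
    have "cov_tensor11 D \<phi> X Y = 0"
      using assms(2) X Y unfolding parallel11_def by blast
    from fun_cong[OF this, of p] show ?thesis
      using Kphi[OF t] phiK
      by (simp add: cov_tensor11_def D_at X Y phi_vfield)
         (simp add: apply11_def D_at X Y phi_tangent(2) t K_tangent vfield_tangent D0_vfield)
  qed
  then have "parallel11 A D0 \<phi>"
    unfolding parallel11_def by (simp add: fun_eq_iff)
  moreover have "phi_sectional_K_curvature \<phi> g K p u = 0"
    if "generates_phi_section A \<phi> \<xi> g p u" for p u
  proof -
    have u: "u \<in> tangent_space A p" using that by (simp add: generates_phi_section_def)
    have "K_bracket K p u (\<phi> p u) (\<phi> p u) = 0"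
      by (simp add: K_bracket_def Kphi u phi_tangent(1) K_zero)
    then show ?thesis by (simp add: phi_sectional_K_curvature_def g_zero u)
  qed
  ultimately show ?thesis
    by (auto intro!: cosymplectic_statistical_manifold.intro assms(1)
        cosymplectic_statistical_manifold_axioms.intro)
qed

end
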